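(* Let $V_{\det}\subseteq\mathbb A^4$ be the hypersurface $X_1X_4=X_2X_3$ (whose positive points are the positive rank-one $2\times2$ matrices), and let $\mathscr Y_{V_{\det}}$ be its rational-ray visibility datum. Then $$\mathfrak d^{\mathrm{vis}}(\mathscr Y_{V_{\det}})=\frac1{\zeta(2)},\qquad \mathfrak d_p^{\mathrm{vis}}(\mathscr Y_{V_{\det}})=1-\frac1{p^2}$$ for every prime $p$. Visibility is locally detectable (a branch point is globally visible if and only if it is $p$-adically visible for every prime $p$), and the global density is the Euler product of the local densities, $\mathfrak d^{\mathrm{vis}}(\mathscr Y_{V_{\det}})=\prod_p\mathfrak d_p^{\mathrm{vis}}(\mathscr Y_{V_{\det}})$.
   Context: Rational-ray datum of a homogeneous affine variety $V\subseteq\mathbb A^n$ over $\mathbb Q$: for every class $[v]\in(V(\mathbb Q)\cap\mathbb Q_{>0}^n)/\mathbb Q_{>0}$ choose a representative $v$ and take the ordered branch $\phi_{[v]}(t)=tv$, $t>0$. The branch locus is $\mathcal B=V(\mathbb Z)\cap\mathbb Z_{>0}^n$. For $P\in\mathbb Z^n$, $v_p(P)=\min_iv_p(P_i)$ and $H(P)=\max_i|P_i|$. A branch point $\phi_{[v]}(t)$ is globally visible if there is no real $s$ with $0<s<t$ and $\phi_{[v]}(s)\in\mathbb Z^n$; it is $p$-adically visible if $v_p(\phi_{[v]}(t))\le v_p(\phi_{[v]}(s))$ for all such $s$. $\mathfrak d^{\mathrm{vis}}$ (resp. $\mathfrak d_p^{\mathrm{vis}}$) is the limit as $X\to\infty$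 of the proportion of globally visible (resp. $p$-adically visible) points among the points of $\mathcal B$ with $H\le X$. $\zeta$ is the Riemann zeta function. *)

theory Defs
  imports "HOL-Analysis.Analysis" "HOL-Computational_Algebra.Primes" "HOL-Library.Extended_Nat"
begin

text \<open>
  A variety \<open>V\<close> over the rationals enters only through its real points \<open>V :: (real ^ 'n) set\<close>; its
  rational and integral points are the elements of \<open>V\<close> all of whose coordinates lie in \<open>\<rat>\<close>
  and \<open>\<int>\<close>, respectively.
\<close>

definition int_points :: "(real ^ 'n) set" where
  "int_points = {x. \<forall>i. x $ i \<in> \<int>}"

definition rat_points :: "(real ^ 'n) set" where
  "rat_points = {x. \<forall>i. x $ i \<in> \<rat>}"

definition pos_points :: "(real ^ 'n) set" where
  "pos_points = {x. \<forall>i. x $ i > 0}"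

definition ray_rel :: "(real ^ 'n) set \<Rightarrow> ((real ^ 'n) \<times> (real ^ 'n)) set" where
  "ray_rel V = {(x, y). x \<in> V \<inter> rat_points \<inter> pos_points \<and> y \<in> V \<inter> rat_points \<inter> pos_points \<and>
                        (\<exists>c\<in>\<rat>. c > 0 \<and> y = c *\<^sub>R x)}"

definition ray_classes :: "(real ^ 'n) set \<Rightarrow> (real ^ 'n) set set" where
  "ray_classes V = (V \<inter> rat_points \<inter> pos_points) // ray_rel V"

text \<open>
  The rational-ray datum of \<open>V\<close> depends on a choice of representatives \<open>rep\<close>, one for each class;
  the notions below take both \<open>V\<close> and \<open>rep\<close> as arguments.
\<close>

definition ray_representatives :: "(real ^ 'n) set \<Rightarrow> ((real ^ 'n) set \<Rightarrow> real ^ 'n) \<Rightarrow> bool" where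
  "ray_representatives V rep \<longleftrightarrow> (\<forall>C \<in> ray_classes V. rep C \<in> C)"

definition branch ::
    "((real ^ 'n) set \<Rightarrow> real ^ 'n) \<Rightarrow> (real ^ 'n) set \<Rightarrow> real \<Rightarrow> real ^ 'n" where
  "branch rep C t = t *\<^sub>R rep C"

definition branch_locus :: "(real ^ 'n) set \<Rightarrow> (real ^ 'n) set" where
  "branch_locus V = V \<inter> int_points \<inter> pos_points"

definition int_valuation :: "nat \<Rightarrow> int \<Rightarrow> enat" where
  "int_valuation p k = (if k = 0 then \<infinity> else enat (multiplicity (int p) k))"

text \<open>Only meaningful on \<open>int_points\<close>, where the floor merely converts the type.\<close>

definition valuation :: "nat \<Rightarrow> real ^ 'n \<Rightarrow> enat" where
  "valuation p x = Min (range (\<lambda>i. int_valuation p \<lfloor>x $ i\<rfloor>))"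

definition height :: "real ^ 'n \<Rightarrow> real" where
  "height x = Max (range (\<lambda>i. \<bar>x $ i\<bar>))"

definition globally_visible ::
    "((real ^ 'n) set \<Rightarrow> real ^ 'n) \<Rightarrow> (real ^ 'n) set \<Rightarrow> real \<Rightarrow> bool" where
  "globally_visible rep C t \<longleftrightarrow> \<not> (\<exists>s. 0 < s \<and> s < t \<and> branch rep C s \<in> int_points)"

definition locally_visible ::
    "nat \<Rightarrow> ((real ^ 'n) set \<Rightarrow> real ^ 'n) \<Rightarrow> (real ^ 'n) set \<Rightarrow> real \<Rightarrow> bool" where
  "locally_visible p rep C t \<longleftrightarrow>
     (\<forall>s. 0 < s \<and> s < t \<and> branch rep C s \<in> int_points \<longrightarrow>
        valuation p (branch rep C t) \<le> valuation p (branch rep C s))"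

definition globally_visible_points ::
    "(real ^ 'n) set \<Rightarrow> ((real ^ 'n) set \<Rightarrow> real ^ 'n) \<Rightarrow> (real ^ 'n) set" where
  "globally_visible_points V rep =
     {P \<in> branch_locus V. \<exists>C\<in>ray_classes V. \<exists>t>0. P = branch rep C t \<and> globally_visible rep C t}"

definition locally_visible_points ::
    "nat \<Rightarrow> (real ^ 'n) set \<Rightarrow> ((real ^ 'n) set \<Rightarrow> real ^ 'n) \<Rightarrow> (real ^ 'n) set" where
  "locally_visible_points p V rep =
     {P \<in> branch_locus V. \<exists>C\<in>ray_classes V. \<exists>t>0. P = branch rep C t \<and> locally_visible p rep C t}"

definition proportion :: "(real ^ 'n) set \<Rightarrow> (real ^ 'n) set \<Rightarrow> real \<Rightarrow> real" where
  "proportion S B X =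
     real (card {P \<in> S. height P \<le> X}) / real (card {P \<in> B. height P \<le> X})"

definition has_density :: "(real ^ 'n) set \<Rightarrow> (real ^ 'n) set \<Rightarrow> real \<Rightarrow> bool" where
  "has_density S B d \<longleftrightarrow> (proportion S B \<longlongrightarrow> d) at_top"

text \<open>The two densities are unspecified values if the respective limit does not exist.\<close>

definition global_vis_density ::
    "(real ^ 'n) set \<Rightarrow> ((real ^ 'n) set \<Rightarrow> real ^ 'n) \<Rightarrow> real" where
  "global_vis_density V rep = (THE d. has_density (globally_visible_points V rep) (branch_locus V) d)"

definition local_vis_density ::
    "nat \<Rightarrow> (real ^ 'n) set \<Rightarrow> ((real ^ 'n) set \<Rightarrow> real ^ 'n) \<Rightarrow> real" where
  "local_vis_density p V rep = (THE d. has_density (locally_visible_points p V rep) (branch_locus V) d)"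

definition locally_detectable ::
    "(real ^ 'n) set \<Rightarrow> ((real ^ 'n) set \<Rightarrow> real ^ 'n) \<Rightarrow> bool" where
  "locally_detectable V rep \<longleftrightarrow>
     (\<forall>C\<in>ray_classes V. \<forall>t>0. branch rep C t \<in> branch_locus V \<longrightarrow>
        (globally_visible rep C t \<longleftrightarrow> (\<forall>p. prime p \<longrightarrow> locally_visible p rep C t)))"

definition V_det :: "(real ^ 4) set" where
  "V_det = {x. x $ 1 * x $ 4 = x $ 2 * x $ 3}"

text \<open>The Riemann zeta function on real arguments \<open>s > 1\<close>, where it is given by its Dirichlet series.\<close>

definition zeta :: "real \<Rightarrow> real" where
  "zeta s = (\<Sum>n. 1 / real (Suc n) powr s)"

end

theory Submission
  imports Defs
begin

text \<open>
  Let \<open>g\<close> be the gcd of the coordinates of a positive integral point \<open>P\<close>. The integral points on the ray through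
  \<open>P\<close> are the positive integer multiples of \<open>P / g\<close>, so \<open>P\<close> is globally visible iff \<open>g = 1\<close>. The point
  \<open>P / g\<close> has \<open>p\<close>-adic valuation \<open>0\<close> and lies before \<open>P\<close> as soon as \<open>g > 1\<close>, so \<open>P\<close> is \<open>p\<close>-adically
  visible iff \<open>p\<close> does not divide \<open>g\<close>. Local detectability is then the fact that every positive integer other
  than \<open>1\<close> has a prime factor, and the densities ask how \<open>g\<close> is distributed on the points of height at
  most \<open>X\<close>.

  Multiplication by \<open>d\<close> is a bijection from the points of height at most \<open>X / d\<close> onto the points of height
  at most \<open>X\<close> with \<open>d dvd g\<close>. Writing \<open>F X\<close> for the number of points of height at most \<open>X\<close>, the
  proportion of points with \<open>d dvd g\<close> is therefore \<open>F (X / d) / F X\<close>. Suppose that this tends to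
  \<open>1 / d\<^sup>2\<close> for every \<open>d\<close> and never exceeds \<open>1 / d\<^sup>2\<close>. Taking complements gives the local densities
  \<open>1 - 1 / p\<^sup>2\<close>. Inclusion and exclusion over the primes up to \<open>k\<close> gives the product of these factors as
  the limiting proportion of points whose \<open>g\<close> has no prime factor up to \<open>k\<close>; the points among them with
  \<open>g \<noteq> 1\<close> have \<open>g > k\<close>, and by the uniform bound their proportion is at most \<open>\<Sum>d>k. 1 / d\<^sup>2 \<le> 1 / k\<close>.
  Hence the global density is the Euler product (\<open>tendsto_weight_one\<close>). The same argument, applied to the
  weights \<open>1 / (n\<^sup>2 * zeta 2)\<close> on the natural numbers, in which \<open>1\<close> has weight \<open>1 / zeta 2\<close>, evaluates the
  Euler product as \<open>1 / zeta 2\<close>.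

  It remains to compare \<open>F (X / d)\<close> with \<open>F X\<close> on the determinantal hypersurface. A positive
  integral rank-one matrix is uniquely an outer product of a positive integral vector and a coprime pair
  \<open>y\<close>, and its height is the product of the two maxima, so
  \<open>F X = (\<Sum>y. \<lfloor>X / max y\<rfloor>\<^sup>2)\<close> over the coprime pairs. Passing from \<open>X\<close> to \<open>X / d\<close> replaces each floor \<open>k\<close> by
  \<open>k div d\<close>, whence \<open>d\<^sup>2 * F (X / d) \<le> F X\<close> with an error of at most \<open>4 * d * X\<^sup>2\<close>
  (\<open>height_count_det_divide_le\<close>). This error is negligible, because \<open>F X / X\<^sup>2\<close> is bounded below by a multiple
  of a partial sum of the divergent harmonic series (\<open>height_count_det_ge\<close>).
\<close>

section \<open>Weights on the natural numbers and the Euler product of the inverse squares\<close>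

text \<open>
  The summand is at most \<open>1 / (d - 1) - 1 / d\<close>, and the sum of these differences telescopes.
\<close>

lemma inverse_squares_tail_le:
  assumes "0 < k"
  shows "(\<Sum>d\<in>{k<..n}. 1 / (real d)\<^sup>2) \<le> 1 / real k"
proof (cases "k \<le> n")
  case True
  then have "(\<Sum>d\<in>{k<..n}. 1 / (real d)\<^sup>2) \<le> 1 / real k - 1 / real n"
  proof (induction n rule: dec_induct)
    case base
    then show ?case by simp
  next
    case (step n)
    have "{k<..Suc n} = insert (Suc n) {k<..n}" using step.hyps by auto
    moreover have "1 / (real (Suc n))\<^sup>2 \<le> 1 / real n - 1 / real (Suc n)"
    proof -
      have "0 < real n" using step.hyps assms by simp
      then have "1 / real n - 1 / real (Suc n) = 1 / (real n * real (Suc n))"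
        by (simp add: field_simps)
      also have "\<dots> \<ge> 1 / (real (Suc n))\<^sup>2"
        using \<open>0 < real n\<close> by (intro frac_le) (auto simp: power2_eq_square)
      finally show ?thesis .
    qed
    ultimately show ?case using step.IH by simp
  qed
  then show ?thesis by (smt (verit) of_nat_0_le_iff zero_le_divide_1_iff)
qed simp

text \<open>
  Inclusion and exclusion, one prime at a time: for coprime \<open>q\<close> and \<open>d\<close>, excluding the multiples of \<open>q\<close>
  from the multiples of \<open>d\<close> removes the multiples of \<open>d * q\<close>, so the limit is multiplied by
  \<open>1 - 1 / q\<^sup>2\<close>. The parameter \<open>d\<close> is there because this step uses the claim for \<open>d\<close> and for \<open>d * q\<close>.
\<close>

lemma tendsto_weight_avoiding_primes:
  fixes w :: "'x \<Rightarrow> nat set \<Rightarrow> real"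
  assumes add: "\<And>x A B. A \<inter> B = {} \<Longrightarrow> w x (A \<union> B) = w x A + w x B"
    and mult: "\<And>d. d > 0 \<Longrightarrow> ((\<lambda>x. w x {n. d dvd n}) \<longlongrightarrow> 1 / (real d)\<^sup>2) F"
    and "finite Q" and "\<And>q. q \<in> Q \<Longrightarrow> prime q" and "d > 0" and "\<And>q. q \<in> Q \<Longrightarrow> \<not> q dvd d"
  shows "((\<lambda>x. w x {n. d dvd n \<and> (\<forall>q\<in>Q. \<not> q dvd n)}) \<longlongrightarrow>
           1 / (real d)\<^sup>2 * (\<Prod>q\<in>Q. 1 - 1 / (real q)\<^sup>2)) F"
  using assms(3-)
proof (induction Q arbitrary: d rule: finite_induct)
  case empty
  then show ?case using mult by simp
next
  case (insert q Q)
  let ?A = "\<lambda>d. {n. d dvd n \<and> (\<forall>q\<in>Q. \<not> q dvd n)}"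
  have q: "prime q" and qd: "coprime q d"
    using insert.prems by (auto intro: prime_imp_coprime)
  have ndvd: "\<not> r dvd d * q" if "r \<in> Q" for r
  proof -
    have "prime r" "\<not> r dvd d" using insert.prems that by auto
    moreover have "\<not> r dvd q" using that insert.hyps(2) \<open>prime r\<close> q primes_dvd_imp_eq by blast
    ultimately show ?thesis by (simp add: prime_dvd_mult_iff)
  qed
  have dq: "(\<forall>n. d * q dvd n \<longleftrightarrow> d dvd n \<and> q dvd n)"
    using qd by (metis coprime_commute divides_mult dvd_mult_left dvd_mult_right)
  have split: "?A d = {n. d dvd n \<and> (\<forall>r\<in>insert q Q. \<not> r dvd n)} \<union> ?A (d * q)"
    using dq by auto
  have eq: "w x {n. d dvd n \<and> (\<forall>r\<in>insert q Q. \<not> r dvd n)} = w x (?A d) - w x (?A (d * q))" for x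
    using dq by (subst split, subst add) auto
  have "((\<lambda>x. w x (?A d) - w x (?A (d * q))) \<longlongrightarrow>
      1 / (real d)\<^sup>2 * (\<Prod>q\<in>Q. 1 - 1 / (real q)\<^sup>2) - 1 / (real (d * q))\<^sup>2 * (\<Prod>q\<in>Q. 1 - 1 / (real q)\<^sup>2)) F"
    using insert.prems q ndvd by (intro tendsto_diff insert.IH) (auto simp: prime_gt_0_nat)
  also have "1 / (real d)\<^sup>2 * (\<Prod>q\<in>Q. 1 - 1 / (real q)\<^sup>2) - 1 / (real (d * q))\<^sup>2 * (\<Prod>q\<in>Q. 1 - 1 / (real q)\<^sup>2)
     = 1 / (real d)\<^sup>2 * (\<Prod>q\<in>insert q Q. 1 - 1 / (real q)\<^sup>2)"
    using insert.hyps by (simp add: algebra_simps power_mult_distrib)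
  finally show ?case unfolding eq .
qed

text \<open>
  The number \<open>1\<close> is what remains of the numbers without prime factors up to \<open>k\<close> when those beyond \<open>k\<close>
  are discarded, and the tail bound makes the discarded weight small uniformly along the filter. The
  limit \<open>L\<close> is a parameter so that the lemma can also serve to identify it.
\<close>

lemma tendsto_weight_one:
  fixes w :: "'x \<Rightarrow> nat set \<Rightarrow> real"
  assumes add: "\<And>x A B. A \<inter> B = {} \<Longrightarrow> w x (A \<union> B) = w x A + w x B"
    and nonneg: "\<And>x A. w x A \<ge> 0"
    and mult: "\<And>d. d > 0 \<Longrightarrow> ((\<lambda>x. w x {n. d dvd n}) \<longlongrightarrow> 1 / (real d)\<^sup>2) F"
    and tail: "\<And>k. k > 0 \<Longrightarrow> \<forall>\<^sub>F x in F. w x {k<..} \<le> 1 / real k"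
    and lim: "(\<lambda>k. \<Prod>p | prime p \<and> p \<le> k. 1 - 1 / (real p)\<^sup>2) \<longlonglongrightarrow> L"
  shows "((\<lambda>x. w x {1}) \<longlongrightarrow> L) F"
proof (rule tendstoI)
  fix e :: real assume "e > 0"
  define E where "E = (\<lambda>k. \<Prod>p | prime p \<and> p \<le> k. 1 - 1 / (real p)\<^sup>2)"
  have ev1: "\<forall>\<^sub>F k in sequentially. dist (E k) L < e / 3"
    using lim \<open>e > 0\<close> by (auto simp: E_def dest: tendstoD[where e = "e/3"])
  have "(\<lambda>k. 1 / real k) \<longlonglongrightarrow> 0" by (rule lim_1_over_n)
  then have ev2: "\<forall>\<^sub>F k in sequentially. dist (1 / real k) 0 < e / 3"
    using \<open>e > 0\<close> by (auto dest: tendstoD[where e = "e/3"])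
  (* k \<ge> 2 makes 2 one of the excluded primes, which keeps 0 out of the set A below. *)
  obtain k where k: "dist (E k) L < e / 3" "1 / real k < e / 3" "k \<ge> 2"
    using eventually_happens'[OF _ eventually_conj[OF ev1 eventually_conj[OF ev2 eventually_ge_at_top[of 2]]]]
    by auto
  define A where "A = {n. 1 dvd n \<and> (\<forall>q\<in>{p. prime p \<and> p \<le> k}. \<not> q dvd n)}"
  have "((\<lambda>x. w x A) \<longlongrightarrow> 1 / (real 1)\<^sup>2 * E k) F"
    unfolding A_def E_def
    by (rule tendsto_weight_avoiding_primes[OF add mult]) auto
  then have "\<forall>\<^sub>F x in F. dist (w x A) (E k) < e / 3"
    using \<open>e > 0\<close> by (auto dest: tendstoD[where e = "e/3"])
  moreover have "\<forall>\<^sub>F x in F. w x {k<..} \<le> 1 / real k" using tail k(3) by simp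
  ultimately show "\<forall>\<^sub>F x in F. dist (w x {1}) L < e"
  proof eventually_elim
    case (elim x)
    have "A - {1} \<subseteq> {k<..}"
    proof
      fix n assume n: "n \<in> A - {1}"
      show "n \<in> {k<..}"
      proof (rule ccontr)
        assume "n \<notin> {k<..}"
        then have "n \<le> k" by simp
        have "n \<noteq> 0"
        proof
          assume "n = 0"
          moreover have "\<not> 2 dvd n" using n k(3) two_is_prime_nat unfolding A_def by blast
          ultimately show False by simp
        qed
        moreover obtain p where "prime p" "p dvd n" using n prime_factor_nat[of n] by auto
        ultimately show False using n \<open>n \<le> k\<close> dvd_imp_le[of p n] by (auto simp: A_def)
      qed
    qed
    then have "{k<..} = (A - {1}) \<union> ({k<..} - (A - {1}))" by auto
    then have "w x {k<..} = w x (A - {1}) + w x ({k<..} - (A - {1}))"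
      using add[of "A - {1}" "{k<..} - (A - {1})" x] by auto
    then have 1: "w x (A - {1}) \<le> 1 / real k" using nonneg[of x "{k<..} - (A - {1})"] elim(2) by auto
    have "1 \<in> A" by (auto simp: A_def)
    then have "A = {1} \<union> (A - {1})" by auto
    then have 2: "w x A = w x {1} + w x (A - {1})" using add[of "{1}" "A - {1}" x] by auto
    show ?case using 1 2 nonneg[of x "A - {1}"] elim(1) k(1,2)
      unfolding dist_real_def by linarith
  qed
qed

text \<open>
  The summand at \<open>n = 0\<close> is \<open>1 / 0 = 0\<close>, so the sum over all natural numbers is the Dirichlet series.
\<close>

lemma zeta_2_has_sum: "((\<lambda>n. 1 / (real n)\<^sup>2) has_sum zeta 2) UNIV"
proof -
  have s: "summable (\<lambda>n. 1 / (real n)\<^sup>2)"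
    using inverse_power_summable[of 2, where ?'a = real] by (simp add: inverse_eq_divide)
  have "(\<Sum>n. 1 / (real n)\<^sup>2) = (\<Sum>n. 1 / (real (Suc n))\<^sup>2) + 1 / (real 0)\<^sup>2"
    using suminf_split_head[OF s] by simp
  then have "(\<Sum>n. 1 / (real n)\<^sup>2) = zeta 2" by (simp add: zeta_def)
  then have "(\<lambda>n. 1 / (real n)\<^sup>2) sums zeta 2" using s by (simp add: sums_iff)
  then show ?thesis by (intro sums_nonneg_imp_has_sum) auto
qed

lemma zeta_2_pos: "zeta 2 > 0"
proof -
  have "sum (\<lambda>n. 1 / (real n)\<^sup>2) {1} \<le> zeta 2"
    by (rule finite_sum_le_has_sum[OF zeta_2_has_sum]) auto
  then show ?thesis by simp
qed

text \<open>
  The partial products decrease, so they converge to some \<open>L\<close>. Weighting \<open>n\<close> by \<open>1 / (n\<^sup>2 * zeta 2)\<close> gives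
  the multiples of \<open>d\<close> the weight \<open>1 / d\<^sup>2\<close> exactly, so the constant family of these weights satisfies the
  hypotheses of the sieve, which says that the weight \<open>1 / zeta 2\<close> of \<open>1\<close> is \<open>L\<close>.
\<close>

lemma zeta_2_Euler_product:
  "(\<lambda>k. \<Prod>p | prime p \<and> p \<le> k. 1 - 1 / (real p)\<^sup>2) \<longlonglongrightarrow> 1 / zeta 2"
proof -
  let ?E = "\<lambda>k. \<Prod>p | prime p \<and> p \<le> k. 1 - 1 / (real p)\<^sup>2"
  have fac: "0 \<le> 1 - 1 / (real p)\<^sup>2 \<and> 1 - 1 / (real p)\<^sup>2 \<le> 1" for p :: nat
    by (cases p) (auto simp: field_simps)
  have "decseq ?E"
  proof (rule decseq_SucI)
    fix k
    have "{p. prime p \<and> p \<le> Suc k} =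
        (if prime (Suc k) then insert (Suc k) {p. prime p \<and> p \<le> k} else {p. prime p \<and> p \<le> k})"
      by (auto simp: le_Suc_eq)
    then show "?E (Suc k) \<le> ?E k"
      using fac by (auto intro!: mult_left_le_one_le prod_nonneg)
  qed
  moreover have "0 \<le> ?E k" for k using fac by (auto intro!: prod_nonneg)
  ultimately obtain L where L: "?E \<longlonglongrightarrow> L"
    using decseq_convergent[of ?E 0] by metis
  let ?f = "\<lambda>n. 1 / (real n)\<^sup>2"
  define w where "w = (\<lambda>(_::nat) A. infsum ?f A / zeta 2)"
  have sm: "?f summable_on A" for A
    using has_sum_imp_summable[OF zeta_2_has_sum] summable_on_subset_banach by blast
  have tot: "infsum ?f UNIV = zeta 2" using zeta_2_has_sum by (rule infsumI)
  have "((\<lambda>x. w x {1}) \<longlonglongrightarrow> L)"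
  proof (rule tendsto_weight_one[OF _ _ _ _ L])
    show "w x (A \<union> B) = w x A + w x B" if "A \<inter> B = {}" for x A B
      using that by (simp add: w_def infsum_Un_disjoint[OF sm sm] add_divide_distrib)
    show "w x A \<ge> 0" for x A
      using zeta_2_pos by (auto simp: w_def intro!: divide_nonneg_nonneg infsum_nonneg)
    show "(\<lambda>x. w x {n. d dvd n}) \<longlonglongrightarrow> 1 / (real d)\<^sup>2" if "d > 0" for d
    proof -
      have "{n. d dvd n} = (*) d ` UNIV" by (auto elim: dvdE)
      then have "infsum ?f {n. d dvd n} = infsum (?f \<circ> (*) d) UNIV"
        using that by (simp add: infsum_reindex inj_on_def)
      also have "\<dots> = 1 / (real d)\<^sup>2 * infsum ?f UNIV"
        by (subst infsum_cmult_right'[symmetric]) (simp add: o_def power_mult_distrib)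
      finally show ?thesis using zeta_2_pos by (simp add: w_def tot)
    qed
    show "\<forall>\<^sub>F x in sequentially. w x {k<..} \<le> 1 / real k" if "k > 0" for k
    proof -
      have "infsum ?f {k<..} \<le> 1 / real k"
      proof (rule infsum_le_finite_sums[OF sm])
        fix G assume G: "finite G" "G \<subseteq> {k<..}"
        have "sum ?f G \<le> sum ?f {k<..Max G}"
          using G by (intro sum_mono2) auto
        also have "\<dots> \<le> 1 / real k" by (rule inverse_squares_tail_le[OF that])
        finally show "sum ?f G \<le> 1 / real k" .
      qed
      moreover have "zeta 2 \<ge> 1"
        using finite_sum_le_has_sum[OF zeta_2_has_sum, of "{1}"] by auto
      moreover have "infsum ?f {k<..} \<ge> 0" by (auto intro: infsum_nonneg)
      ultimately have "infsum ?f {k<..} / zeta 2 \<le> infsum ?f {k<..} / 1"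
        by (intro divide_left_mono) auto
      then show ?thesis using \<open>infsum ?f {k<..} \<le> 1 / real k\<close> by (simp add: w_def)
    qed
  qed
  then have "L = 1 / zeta 2"
    by (simp add: w_def LIMSEQ_const_iff)
  then show ?thesis using L by simp
qed

section \<open>Visibility and the gcd of the coordinates\<close>

definition coord_gcd :: "real ^ 'n \<Rightarrow> nat" where
  "coord_gcd x = nat (Gcd (range (\<lambda>i. \<lfloor>x $ i\<rfloor>)))"

lemma dvd_coord_gcd_iff: "d dvd coord_gcd x \<longleftrightarrow> (\<forall>i. int d dvd \<lfloor>x $ i\<rfloor>)"
proof -
  have "d dvd coord_gcd x \<longleftrightarrow> int d dvd Gcd (range (\<lambda>i. \<lfloor>x $ i\<rfloor>))"
    unfolding coord_gcd_def by (metis Gcd_int_greater_eq_0 int_dvd_int_iff nat_0_le)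
  then show ?thesis by (auto simp: dvd_Gcd_iff)
qed

lemma int_points_floor: "x \<in> int_points \<Longrightarrow> of_int \<lfloor>x $ i\<rfloor> = x $ i"
  by (simp add: int_points_def)

lemma coord_gcd_dvd_coord: "int (coord_gcd x) dvd \<lfloor>x $ i\<rfloor>"
  using dvd_coord_gcd_iff[of "coord_gcd x" x] by simp

lemma coord_gcd_pos:
  assumes "x \<in> int_points" and "x \<in> pos_points"
  shows "coord_gcd x > 0"
proof (rule ccontr)
  assume "\<not> coord_gcd x > 0"
  then have "\<lfloor>x $ i\<rfloor> = 0" for i using coord_gcd_dvd_coord[of x i] by simp
  then have "x $ i = 0" for i using int_points_floor[OF assms(1), of i] by simp
  then show False using assms(2) by (simp add: pos_points_def)
qed

lemma height_le_iff: "height x \<le> X \<longleftrightarrow> (\<forall>i. \<bar>x $ i\<bar> \<le> X)"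
  by (simp add: height_def)

lemma coord_gcd_le_height:
  fixes x :: "real ^ 'n"
  assumes "x \<in> int_points" and "x \<in> pos_points"
  shows "real (coord_gcd x) \<le> height x"
proof -
  obtain i :: 'n where True by simp
  have "\<lfloor>x $ i\<rfloor> > 0"
    using assms int_points_floor[OF assms(1), of i]
    by (metis mem_Collect_eq of_int_0_less_iff pos_points_def)
  then have "int (coord_gcd x) \<le> \<lfloor>x $ i\<rfloor>" by (rule zdvd_imp_le[OF coord_gcd_dvd_coord])
  then have "real (coord_gcd x) \<le> x $ i"
    by (metis assms(1) int_points_floor of_int_le_iff of_int_of_nat_eq)
  also have "\<dots> \<le> height x" using height_le_iff[of x "height x"] by (smt (verit))
  finally show ?thesis .
qed

text \<open>
  Bezout: the gcd is an integral linear combination of the elements.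
\<close>

lemma Ints_mult_Gcd:
  fixes r :: real
  assumes "finite A" and "\<And>a. a \<in> A \<Longrightarrow> r * of_int a \<in> \<int>"
  shows "r * of_int (Gcd A) \<in> \<int>"
  using assms
proof (induction A rule: finite_induct)
  case (insert a A)
  obtain u v where uv: "u * a + v * Gcd A = gcd a (Gcd A)" using bezout_int by blast
  have "r * of_int (Gcd (insert a A)) = of_int u * (r * of_int a) + of_int v * (r * of_int (Gcd A))"
    by (simp add: uv[symmetric] algebra_simps)
  also have "\<dots> \<in> \<int>" using insert by (intro Ints_add Ints_mult[OF Ints_of_int]) auto
  finally show ?case .
qed simp

text \<open>
  This describes the integral points on a ray: they are the integer multiples of \<open>x\<close> divided by the gcd of
  its coordinates.
\<close>

lemma scaleR_in_int_points_iff: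
  assumes "x \<in> int_points"
  shows "r *\<^sub>R x \<in> int_points \<longleftrightarrow> r * real (coord_gcd x) \<in> \<int>"
proof
  assume r: "r *\<^sub>R x \<in> int_points"
  have "r * of_int (Gcd (range (\<lambda>i. \<lfloor>x $ i\<rfloor>))) \<in> \<int>"
  proof (rule Ints_mult_Gcd)
    fix a assume "a \<in> range (\<lambda>i. \<lfloor>x $ i\<rfloor>)"
    then obtain i where "a = \<lfloor>x $ i\<rfloor>" by blast
    then have "r * of_int a = (r *\<^sub>R x) $ i" using int_points_floor[OF assms, of i] by simp
    moreover have "(r *\<^sub>R x) $ i \<in> \<int>" using r unfolding int_points_def by blast
    ultimately show "r * of_int a \<in> \<int>" by metis
  qed simp
  moreover have "real (coord_gcd x) = of_int (Gcd (range (\<lambda>i. \<lfloor>x $ i\<rfloor>)))" by (simp add: coord_gcd_def)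
  ultimately show "r * real (coord_gcd x) \<in> \<int>" by simp
next
  assume r: "r * real (coord_gcd x) \<in> \<int>"
  have "r * x $ i \<in> \<int>" for i
  proof -
    obtain k where "\<lfloor>x $ i\<rfloor> = int (coord_gcd x) * k" using coord_gcd_dvd_coord[of x i] by (auto elim: dvdE)
    then have "x $ i = real (coord_gcd x) * of_int k"
      by (metis assms int_points_floor of_int_mult of_int_of_nat_eq)
    then have "r * x $ i = (r * real (coord_gcd x)) * of_int k" by simp
    then show ?thesis using r by (metis Ints_mult Ints_of_int)
  qed
  then show "r *\<^sub>R x \<in> int_points" by (simp add: int_points_def)
qed

lemma int_valuation_eq_0_iff: "prime p \<Longrightarrow> int_valuation p k = 0 \<longleftrightarrow> \<not> int p dvd k"
  using multiplicity_eq_zero_iff[of k "int p"] prime_gt_1_nat[of p]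
  by (auto simp: int_valuation_def zero_enat_def)

lemma valuation_eq_0_iff:
  assumes "prime p"
  shows "valuation p x = 0 \<longleftrightarrow> \<not> p dvd coord_gcd x"
proof -
  let ?R = "range (\<lambda>i. int_valuation p \<lfloor>x $ i\<rfloor>)"
  have "Min ?R = 0 \<longleftrightarrow> 0 \<in> ?R"
  proof
    assume "Min ?R = 0"
    then show "0 \<in> ?R" using Min_in[of ?R] by force
  next
    assume "0 \<in> ?R"
    then show "Min ?R = 0" using Min_le[of ?R 0] by simp
  qed
  then show ?thesis
    using int_valuation_eq_0_iff[OF assms] unfolding valuation_def dvd_coord_gcd_iff image_iff
    by (metis UNIV_I)
qed

lemma branch_rescale:
  assumes "t > 0"
  shows "branch rep C s = (s / t) *\<^sub>R branch rep C t"
  using assms by (simp add: branch_def)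

text \<open>
  The witness is the point divided by the gcd of its coordinates. It obstructs both global visibility and,
  for every prime dividing the gcd, local visibility.
\<close>

lemma branch_primitive:
  assumes "t > 0" and "branch rep C t \<in> int_points" and "branch rep C t \<in> pos_points"
    and "coord_gcd (branch rep C t) \<noteq> 1"
  obtains s where "0 < s" "s < t" "branch rep C s \<in> int_points" "coord_gcd (branch rep C s) = 1"
proof
  let ?P = "branch rep C t"
  let ?g = "coord_gcd ?P" let ?s = "t / real ?g"
  have g: "?g > 0" using coord_gcd_pos assms by blast
  show "0 < ?s" "?s < t" using assms g by (auto simp: field_simps)
  have s: "branch rep C ?s = (1 / real ?g) *\<^sub>R ?P"
    using branch_rescale[OF assms(1), of rep C ?s] assms(1) by simp
  show int: "branch rep C ?s \<in> int_points"
    unfolding s using assms(2) g by (subst scaleR_in_int_points_iff) auto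
  have "coord_gcd (branch rep C ?s) * ?g dvd ?g"
    unfolding dvd_coord_gcd_iff[of _ ?P]
  proof
    fix i
    have "of_int \<lfloor>?P $ i\<rfloor> = real ?g * of_int \<lfloor>branch rep C ?s $ i\<rfloor>"
      using g by (simp add: int_points_floor[OF int] int_points_floor[OF assms(2)]) (simp add: s)
    then have "\<lfloor>?P $ i\<rfloor> = int ?g * \<lfloor>branch rep C ?s $ i\<rfloor>"
      by (metis of_int_eq_iff of_int_mult of_int_of_nat_eq)
    then show "int (coord_gcd (branch rep C ?s) * ?g) dvd \<lfloor>?P $ i\<rfloor>"
      using coord_gcd_dvd_coord[of "branch rep C ?s" i] by simp
  qed
  then show "coord_gcd (branch rep C ?s) = 1" using g by auto
qed

lemma globally_visible_iff_coord_gcd: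
  assumes "t > 0" and "branch rep C t \<in> branch_locus V"
  shows "globally_visible rep C t \<longleftrightarrow> coord_gcd (branch rep C t) = 1"
proof
  have P: "branch rep C t \<in> int_points" "branch rep C t \<in> pos_points"
    using assms by (auto simp: branch_locus_def)
  show "coord_gcd (branch rep C t) = 1" if "globally_visible rep C t"
    using branch_primitive[OF assms(1) P] that unfolding globally_visible_def by metis
  assume c: "coord_gcd (branch rep C t) = 1"
  show "globally_visible rep C t"
    unfolding globally_visible_def
  proof clarify
    fix s assume s: "0 < s" "s < t" "branch rep C s \<in> int_points"
    then have "s / t \<in> \<int>"
      using scaleR_in_int_points_iff[OF P(1), of "s / t"] branch_rescale[OF assms(1), of rep C s] c by simp
    then obtain k where "s / t = of_int k" by (rule Ints_cases)
    moreover have "0 < s / t" "s / t < 1" using s by auto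
    ultimately show False by simp
  qed
qed

text \<open>
  If \<open>p\<close> does not divide the gcd, the valuation of the point is \<open>0\<close>, the least possible value. If it does,
  the primitive point earlier on the branch has the smaller valuation \<open>0\<close>.
\<close>

lemma locally_visible_iff_coord_gcd:
  assumes "prime p" and "t > 0" and "branch rep C t \<in> branch_locus V"
  shows "locally_visible p rep C t \<longleftrightarrow> \<not> p dvd coord_gcd (branch rep C t)"
proof
  have P: "branch rep C t \<in> int_points" "branch rep C t \<in> pos_points"
    using assms by (auto simp: branch_locus_def)
  show "locally_visible p rep C t" if "\<not> p dvd coord_gcd (branch rep C t)"
    using that valuation_eq_0_iff[OF assms(1), of "branch rep C t"] by (simp add: locally_visible_def)
  assume vis: "locally_visible p rep C t"
  show "\<not> p dvd coord_gcd (branch rep C t)"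
  proof
    assume p: "p dvd coord_gcd (branch rep C t)"
    then have "coord_gcd (branch rep C t) \<noteq> 1" using assms(1) not_prime_unit by metis
    then obtain s where s: "0 < s" "s < t" "branch rep C s \<in> int_points" "coord_gcd (branch rep C s) = 1"
      using branch_primitive[OF assms(2) P] by metis
    have "valuation p (branch rep C s) = 0"
      unfolding valuation_eq_0_iff[OF assms(1)] s(4) using assms(1) not_prime_unit by blast
    moreover have "valuation p (branch rep C t) \<le> valuation p (branch rep C s)"
      using vis s(1-3) unfolding locally_visible_def by blast
    ultimately have "valuation p (branch rep C t) = 0" by simp
    then show False unfolding valuation_eq_0_iff[OF assms(1)] using p by contradiction
  qed
qed

text \<open>
  The branch of the class of \<open>P\<close> runs through \<open>P\<close> whichever representative was chosen, since the chosen
  representative is a positive multiple of \<open>P\<close>.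
\<close>

lemma branch_locus_on_branch:
  assumes "ray_representatives V rep" and P: "P \<in> branch_locus V"
  obtains C t where "C \<in> ray_classes V" "t > 0" "P = branch rep C t"
proof -
  have "P \<in> V \<inter> rat_points \<inter> pos_points"
    using P Ints_subset_Rats by (auto simp: branch_locus_def int_points_def rat_points_def)
  then have C: "ray_rel V `` {P} \<in> ray_classes V" unfolding ray_classes_def by (rule quotientI)
  then have "rep (ray_rel V `` {P}) \<in> ray_rel V `` {P}"
    using assms(1) by (auto simp: ray_representatives_def)
  then obtain c where "c > 0" "rep (ray_rel V `` {P}) = c *\<^sub>R P"
    by (auto simp: ray_rel_def)
  then have "P = branch rep (ray_rel V `` {P}) (1 / c)" "1 / c > 0" by (auto simp: branch_def)
  then show ?thesis using that C by blast
qed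

text \<open>
  Visibility is declared through some branch and parameter representing the point. A property that depends
  only on the point can be read off from any of them.
\<close>

lemma ex_branch_iff:
  assumes "ray_representatives V rep" and "P \<in> branch_locus V"
    and "\<And>C t. t > 0 \<Longrightarrow> P = branch rep C t \<Longrightarrow> v C t \<longleftrightarrow> q"
  shows "(\<exists>C\<in>ray_classes V. \<exists>t>0. P = branch rep C t \<and> v C t) \<longleftrightarrow> q"
proof -
  obtain C t where "C \<in> ray_classes V" "t > 0" "P = branch rep C t"
    using branch_locus_on_branch[OF assms(1,2)] .
  with assms(3) show ?thesis by blast
qed

lemma globally_visible_points_eq:
  assumes "ray_representatives V rep"
  shows "globally_visible_points V rep = {P \<in> branch_locus V. coord_gcd P \<in> {1}}"
  unfolding globally_visible_points_def
proof (intro Collect_cong conj_cong refl ex_branch_iff[OF assms])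
  fix P C and t :: real
  assume "P \<in> branch_locus V" "t > 0" "P = branch rep C t"
  then show "globally_visible rep C t \<longleftrightarrow> coord_gcd P \<in> {1}"
    using globally_visible_iff_coord_gcd[of t rep C V] by simp
qed

lemma locally_visible_points_eq:
  assumes "ray_representatives V rep" and "prime p"
  shows "locally_visible_points p V rep = {P \<in> branch_locus V. coord_gcd P \<in> {n. \<not> p dvd n}}"
  unfolding locally_visible_points_def
proof (intro Collect_cong conj_cong refl ex_branch_iff[OF assms(1)])
  fix P C and t :: real
  assume "P \<in> branch_locus V" "t > 0" "P = branch rep C t"
  then show "locally_visible p rep C t \<longleftrightarrow> coord_gcd P \<in> {n. \<not> p dvd n}"
    using locally_visible_iff_coord_gcd[OF assms(2), of t rep C V] by simp
qed

lemma locally_detectable_ray_datum: "locally_detectable V rep"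
proof -
  have one: "n = 1 \<longleftrightarrow> (\<forall>p. prime p \<longrightarrow> \<not> p dvd n)" for n :: nat
  proof
    show "\<forall>p. prime p \<longrightarrow> \<not> p dvd n" if "n = 1"
      unfolding that by (blast dest: not_prime_unit)
    show "n = 1" if "\<forall>p. prime p \<longrightarrow> \<not> p dvd n"
      using prime_factor_nat[of n] that by blast
  qed
  show ?thesis
    unfolding locally_detectable_def
  proof (intro ballI allI impI)
    fix C and t :: real
    assume *: "0 < t" "branch rep C t \<in> branch_locus V"
    have "globally_visible rep C t \<longleftrightarrow> (\<forall>p. prime p \<longrightarrow> \<not> p dvd coord_gcd (branch rep C t))"
      by (rule trans[OF globally_visible_iff_coord_gcd[OF *] one])
    also have "\<dots> \<longleftrightarrow> (\<forall>p. prime p \<longrightarrow> locally_visible p rep C t)"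
      by (intro all_cong1 imp_cong refl) (simp only: locally_visible_iff_coord_gcd[OF _ *])
    finally show "globally_visible rep C t \<longleftrightarrow> (\<forall>p. prime p \<longrightarrow> locally_visible p rep C t)" .
  qed
qed

section \<open>Densities in a cone\<close>

definition height_count :: "(real ^ 'n) set \<Rightarrow> real \<Rightarrow> nat" where
  "height_count V X = card {P \<in> branch_locus V. height P \<le> X}"

lemma finite_bounded_height:
  fixes V :: "(real ^ 'n) set"
  shows "finite {P \<in> branch_locus V. height P \<le> X}"
proof (rule finite_imageD)
  let ?S = "{P \<in> branch_locus V. height P \<le> X}"
  let ?f = "\<lambda>(P :: real ^ 'n) i. \<lfloor>P $ i\<rfloor>"
  have "?f ` ?S \<subseteq> (UNIV \<rightarrow>\<^sub>E {0..\<lfloor>X\<rfloor>})"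
  proof (intro image_subsetI PiE_I)
    fix P :: "real ^ 'n" and i assume "P \<in> ?S"
    then have "0 < P $ i" "P $ i \<le> X"
      unfolding branch_locus_def pos_points_def height_le_iff by (blast dest: abs_le_D1)+
    then show "\<lfloor>P $ i\<rfloor> \<in> {0..\<lfloor>X\<rfloor>}" by (simp add: floor_mono)
  qed simp
  moreover have "finite (UNIV \<rightarrow>\<^sub>E {0..\<lfloor>X\<rfloor>} :: ('n \<Rightarrow> int) set)" by (rule finite_PiE) auto
  ultimately show "finite (?f ` ?S)" by (rule finite_subset)
  show "inj_on ?f ?S"
  proof (rule inj_onI)
    fix P Q assume *: "P \<in> ?S" "Q \<in> ?S" "?f P = ?f Q"
    have int: "P \<in> int_points" "Q \<in> int_points" using *(1,2) by (auto simp: branch_locus_def)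
    have "P $ i = Q $ i" for i
    proof -
      have "P $ i = of_int \<lfloor>P $ i\<rfloor>" by (rule int_points_floor[OF int(1), symmetric])
      also have "\<lfloor>P $ i\<rfloor> = \<lfloor>Q $ i\<rfloor>" by (rule fun_cong[OF *(3)])
      also have "of_int \<lfloor>Q $ i\<rfloor> = Q $ i" by (rule int_points_floor[OF int(2)])
      finally show ?thesis .
    qed
    then show "P = Q" by (simp add: vec_eq_iff)
  qed
qed

text \<open>
  On a cone, multiplication by \<open>d\<close> multiplies heights by \<open>d\<close>, and its image in the branch locus consists
  of the points all of whose coordinates are divisible by \<open>d\<close>.
\<close>

lemma card_coord_gcd_multiple:
  assumes cone: "\<And>x c. x \<in> V \<Longrightarrow> c > 0 \<Longrightarrow> c *\<^sub>R x \<in> V" and d: "d > 0"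
  shows "card {P \<in> branch_locus V. d dvd coord_gcd P \<and> height P \<le> X} =
         height_count V (X / real d)"
proof -
  have "bij_betw (\<lambda>P. real d *\<^sub>R P) {P \<in> branch_locus V. height P \<le> X / real d}
          {P \<in> branch_locus V. d dvd coord_gcd P \<and> height P \<le> X}"
  proof (rule bij_betw_byWitness[where f' = "\<lambda>P. (1 / real d) *\<^sub>R P"])
    show "(\<lambda>P. real d *\<^sub>R P) ` {P \<in> branch_locus V. height P \<le> X / real d}
        \<subseteq> {P \<in> branch_locus V. d dvd coord_gcd P \<and> height P \<le> X}"
    proof (intro image_subsetI CollectI)
      fix P assume "P \<in> {P \<in> branch_locus V. height P \<le> X / real d}"
      then have P: "P \<in> branch_locus V" "height P \<le> X / real d" by auto
      then have int: "P \<in> int_points" by (simp add: branch_locus_def)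
      have "\<lfloor>(real d *\<^sub>R P) $ i\<rfloor> = int d * \<lfloor>P $ i\<rfloor>" for i
      proof -
        have "(real d *\<^sub>R P) $ i = of_int (int d * \<lfloor>P $ i\<rfloor>)"
          by (simp add: int_points_floor[OF int])
        then show ?thesis by (metis floor_of_int)
      qed
      then have "d dvd coord_gcd (real d *\<^sub>R P)" by (simp add: dvd_coord_gcd_iff)
      then show "real d *\<^sub>R P \<in> branch_locus V \<and> d dvd coord_gcd (real d *\<^sub>R P) \<and> height (real d *\<^sub>R P) \<le> X"
        using P d cone by (auto simp: branch_locus_def int_points_def pos_points_def height_le_iff abs_mult field_simps)
    qed
    show "(\<lambda>P. (1 / real d) *\<^sub>R P) ` {P \<in> branch_locus V. d dvd coord_gcd P \<and> height P \<le> X}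
        \<subseteq> {P \<in> branch_locus V. height P \<le> X / real d}"
    proof (intro image_subsetI CollectI)
      fix P assume "P \<in> {P \<in> branch_locus V. d dvd coord_gcd P \<and> height P \<le> X}"
      then have P: "P \<in> branch_locus V" "d dvd coord_gcd P" "height P \<le> X" by auto
      have "(1 / real d) * real (coord_gcd P) \<in> \<int>" using P(2) d by (auto elim!: dvdE)
      then have "(1 / real d) *\<^sub>R P \<in> int_points"
        using scaleR_in_int_points_iff[of P "1 / real d"] P by (auto simp: branch_locus_def)
      then show "(1 / real d) *\<^sub>R P \<in> branch_locus V \<and> height ((1 / real d) *\<^sub>R P) \<le> X / real d"
        using P d cone[of P "1 / real d"]
        by (auto simp: branch_locus_def pos_points_def height_le_iff abs_mult field_simps)
    qed
  qed (use d in auto)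
  then show ?thesis by (simp add: height_count_def bij_betw_same_card)
qed

text \<open>
  The proportion of points of height at most \<open>X\<close> whose gcd lies in \<open>A\<close> is an additive weight of \<open>A\<close>, to
  which the sieve applies as \<open>X\<close> tends to infinity. The bound is uniform in \<open>d\<close>
  and controls the points whose gcd has only large prime factors.
\<close>

lemma has_density_by_coord_gcd:
  assumes cone: "\<And>x c. x \<in> V \<Longrightarrow> c > 0 \<Longrightarrow> c *\<^sub>R x \<in> V"
    and ratio: "\<And>d. d > 0 \<Longrightarrow>
      ((\<lambda>X. real (height_count V (X / real d)) / real (height_count V X)) \<longlongrightarrow> 1 / (real d)\<^sup>2) at_top"
    and bound: "\<And>d X. d > 0 \<Longrightarrow> X \<ge> 0 \<Longrightarrow>
      (real d)\<^sup>2 * real (height_count V (X / real d)) \<le> real (height_count V X)"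
  shows has_density_coord_gcd_1: "has_density {P \<in> branch_locus V. coord_gcd P \<in> {1}} (branch_locus V) (1 / zeta 2)"
    and has_density_coord_gcd_not_dvd: "p > 0 \<Longrightarrow>
      has_density {P \<in> branch_locus V. coord_gcd P \<in> {n. \<not> p dvd n}} (branch_locus V) (1 - 1 / (real p)\<^sup>2)"
proof -
  define S where "S = (\<lambda>X A. {P \<in> branch_locus V. coord_gcd P \<in> A \<and> height P \<le> X})"
  define w where "w = (\<lambda>X A. real (card (S X A)) / real (height_count V X))"
  have fin: "finite (S X A)" for X A
    by (rule finite_subset[OF _ finite_bounded_height[of V X]]) (auto simp: S_def)
  have proportion: "proportion {P \<in> branch_locus V. coord_gcd P \<in> A} (branch_locus V) = (\<lambda>X. w X A)" for A
    by (rule ext) (simp add: proportion_def w_def S_def height_count_def conj_assoc)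
  have add: "w X (A \<union> B) = w X A + w X B" if "A \<inter> B = {}" for X A B
  proof -
    have "S X (A \<union> B) = S X A \<union> S X B" "S X A \<inter> S X B = {}" using that by (auto simp: S_def)
    then show ?thesis by (simp add: w_def card_Un_disjoint fin add_divide_distrib)
  qed
  have card_multiples: "card (S X {n. d dvd n}) = height_count V (X / real d)" if "d > 0" for X d
    using card_coord_gcd_multiple[OF cone that] by (simp add: S_def)
  have mult: "((\<lambda>X. w X {n. d dvd n}) \<longlongrightarrow> 1 / (real d)\<^sup>2) at_top" if "d > 0" for d
    using ratio[OF that] by (simp add: w_def card_multiples[OF that])
  have tail: "w X {k<..} \<le> 1 / real k" if "k > 0" "X \<ge> 0" for X k
  proof -
    define n where "n = nat \<lfloor>X\<rfloor>"
    (* Each of these points is counted under d = its own gcd, which is at most its height. *)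
    have "S X {k<..} \<subseteq> (\<Union>d\<in>{k<..n}. S X {m. d dvd m})"
    proof
      fix P assume P: "P \<in> S X {k<..}"
      then have "real (coord_gcd P) \<le> X"
        using coord_gcd_le_height[of P] by (auto simp: S_def branch_locus_def)
      then have "coord_gcd P \<le> n" unfolding n_def by (rule le_nat_floor)
      then show "P \<in> (\<Union>d\<in>{k<..n}. S X {m. d dvd m})" using P by (auto simp: S_def intro!: bexI[of _ "coord_gcd P"])
    qed
    then have "card (S X {k<..}) \<le> card (\<Union>d\<in>{k<..n}. S X {m. d dvd m})"
      by (intro card_mono) (auto simp: fin)
    also have "\<dots> \<le> (\<Sum>d\<in>{k<..n}. card (S X {m. d dvd m}))" by (rule card_UN_le) simp
    finally have "real (card (S X {k<..})) \<le> (\<Sum>d\<in>{k<..n}. real (card (S X {m. d dvd m})))"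
      by (metis of_nat_le_iff of_nat_sum)
    also have "\<dots> \<le> (\<Sum>d\<in>{k<..n}. real (height_count V X) * (1 / (real d)\<^sup>2))"
    proof (rule sum_mono)
      fix d assume "d \<in> {k<..n}"
      then have "d > 0" by simp
      then show "real (card (S X {m. d dvd m})) \<le> real (height_count V X) * (1 / (real d)\<^sup>2)"
        using bound[OF _ that(2), of d] by (simp add: card_multiples field_simps)
    qed
    also have "\<dots> \<le> real (height_count V X) * (1 / real k)"
      unfolding sum_distrib_left[symmetric]
      by (intro mult_left_mono inverse_squares_tail_le that) simp
    finally show ?thesis by (cases "height_count V X = 0") (simp_all add: w_def field_simps)
  qed
  have "((\<lambda>X. w X {1}) \<longlongrightarrow> 1 / zeta 2) at_top"
  proof (rule tendsto_weight_one[OF add _ mult _ zeta_2_Euler_product])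
    show "w X A \<ge> 0" for X A by (simp add: w_def)
    show "\<forall>\<^sub>F X in at_top. w X {k<..} \<le> 1 / real k" if "k > 0" for k
      using eventually_ge_at_top[of 0] by eventually_elim (rule tail[OF that])
  qed
  then show "has_density {P \<in> branch_locus V. coord_gcd P \<in> {1}} (branch_locus V) (1 / zeta 2)"
    unfolding has_density_def proportion .
  assume p: "p > 0"
  have "w X {n. \<not> p dvd n} = w X {n. 1 dvd n} - w X {n. p dvd n}" for X
  proof -
    have "{n. 1 dvd n} = {n. \<not> p dvd n} \<union> {n. p dvd n}" by auto
    moreover have "w X ({n. \<not> p dvd n} \<union> {n. p dvd n}) = w X {n. \<not> p dvd n} + w X {n. p dvd n}"
      by (rule add) auto
    ultimately show ?thesis by simp
  qed
  then have "((\<lambda>X. w X {n. \<not> p dvd n}) \<longlongrightarrow> 1 / (real 1)\<^sup>2 - 1 / (real p)\<^sup>2) at_top"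
    using tendsto_diff[OF mult[of 1] mult[OF p]] by simp
  then show "has_density {P \<in> branch_locus V. coord_gcd P \<in> {n. \<not> p dvd n}} (branch_locus V) (1 - 1 / (real p)\<^sup>2)"
    unfolding has_density_def proportion by simp
qed

section \<open>Counting positive rank-one matrices\<close>

text \<open>
  The entries of the rank-one matrix with rows \<open>u * (a, b)\<close> and \<open>v * (a, b)\<close>, read row by row.
\<close>

definition outer_product :: "(nat \<times> nat) \<times> (nat \<times> nat) \<Rightarrow> real ^ 4" where
  "outer_product = (\<lambda>((a, b), (u, v)). vector [real (u * a), real (u * b), real (v * a), real (v * b)])"

definition coprime_pairs :: "nat \<Rightarrow> (nat \<times> nat) set" where
  "coprime_pairs n = {(a, b). a \<in> {1..n} \<and> b \<in> {1..n} \<and> coprime a b}"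

definition pair_max :: "nat \<times> nat \<Rightarrow> nat" where
  "pair_max y = max (fst y) (snd y)"

lemma outer_product_nth:
  "outer_product ((a, b), (u, v)) $ 1 = real (u * a)" "outer_product ((a, b), (u, v)) $ 2 = real (u * b)"
  "outer_product ((a, b), (u, v)) $ 3 = real (v * a)" "outer_product ((a, b), (u, v)) $ 4 = real (v * b)"
  by (simp_all add: outer_product_def vector_def)

lemma outer_product_inj:
  assumes "coprime a b" "coprime a' b'" "u > 0" "a > 0"
    and eq: "outer_product ((a, b), (u, v)) = outer_product ((a', b'), (u', v'))"
  shows "((a, b), (u, v)) = ((a', b'), (u', v'))"
proof -
  have e: "u * a = u' * a'" "u * b = u' * b'" "v * a = v' * a'" "v * b = v' * b'"
    using eq outer_product_nth[of a b u v] outer_product_nth[of a' b' u' v'] by (metis of_nat_eq_iff)+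
  have "u * gcd a b = u' * gcd a' b'" using e by (metis gcd_mult_distrib_nat)
  then have "u = u'" using assms by simp
  then show ?thesis using e assms by auto
qed

text \<open>
  Take \<open>u\<close> to be the gcd of the first row and \<open>(a, b)\<close> the first row divided by \<open>u\<close>. The determinant
  equation reads \<open>a * m 4 = b * m 3\<close>, and coprimality of \<open>a\<close> and \<open>b\<close> makes the second row a multiple of
  \<open>(a, b)\<close> as well.
\<close>

lemma outer_product_surj:
  assumes "P \<in> branch_locus V_det"
  obtains a b u v where "coprime a b" "a > 0" "b > 0" "u > 0" "v > 0" "P = outer_product ((a, b), (u, v))"
proof -
  have int: "P $ i \<in> \<int>" and pos: "P $ i > 0" for i
    using assms by (auto simp: branch_locus_def int_points_def pos_points_def)
  have "\<exists>m>0. P $ i = real m" for i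
    using int[of i] pos[of i] by (metis Ints_cases of_int_0_less_iff of_int_of_nat_eq of_nat_0_less_iff zero_less_imp_eq_int)
  then obtain m where m: "m i > 0" "P $ i = real (m i)" for i by metis
  have det: "m 1 * m 4 = m 2 * m 3"
  proof -
    have "real (m 1 * m 4) = real (m 2 * m 3)"
      using assms by (simp add: branch_locus_def V_det_def m(2))
    then show ?thesis by (simp only: of_nat_eq_iff)
  qed
  define u where "u = gcd (m 1) (m 2)"
  have u: "u > 0" using m(1) by (simp add: u_def)
  obtain a b where ab: "m 1 = a * u" "m 2 = b * u" "coprime a b"
    using gcd_coprime_exists[of "m 1" "m 2"] m(1) unfolding u_def
    by (metis gcd_eq_0_iff less_numeral_extra(3))
  have pos': "a > 0" "b > 0" using ab m(1) by (metis gr0I mult_0 less_numeral_extra(3))+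
  have "a * m 4 = b * m 3" using det u by (simp add: ab)
  then have "a dvd m 3" using ab(3) by (metis coprime_dvd_mult_right_iff dvd_triv_left)
  then obtain v where v: "m 3 = a * v" by (auto elim: dvdE)
  then have v4: "m 4 = b * v" using \<open>a * m 4 = b * m 3\<close> pos' by simp
  have "v > 0" using v m(1) by (metis gr0I mult_0_right less_numeral_extra(3))
  moreover have "P = outer_product ((a, b), (u, v))"
    unfolding vec_eq_iff forall_4 outer_product_nth m(2) ab(1,2) v v4 by (simp add: mult.commute)
  ultimately show ?thesis using that ab(3) pos' u by blast
qed

lemma outer_product_in_branch_locus:
  assumes "a > 0" "b > 0" "u > 0" "v > 0"
  shows "outer_product ((a, b), (u, v)) \<in> branch_locus V_det"
  using assms
  by (simp add: branch_locus_def V_det_def int_points_def pos_points_def forall_4 outer_product_nth)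

lemma height_outer_product_le_iff:
  assumes "a > 0"
  shows "height (outer_product ((a, b), (u, v))) \<le> X \<longleftrightarrow>
    real u \<le> X / real (pair_max (a, b)) \<and> real v \<le> X / real (pair_max (a, b))"
proof -
  have *: "real w \<le> X / real (max a b) \<longleftrightarrow> real (w * a) \<le> X \<and> real (w * b) \<le> X" for w
  proof -
    have "real w \<le> X / real (max a b) \<longleftrightarrow> real (w * max a b) \<le> X"
      using assms by (simp add: pos_le_divide_eq)
    also have "w * max a b = max (w * a) (w * b)" by (rule nat_mult_max_right)
    finally show ?thesis by (metis max.bounded_iff of_nat_max)
  qed
  show ?thesis
    unfolding height_le_iff forall_4 outer_product_nth pair_max_def fst_conv snd_conv * by auto
qed

lemma le_nat_floor_iff: "u > 0 \<Longrightarrow> real u \<le> z \<longleftrightarrow> u \<le> nat \<lfloor>z\<rfloor>"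
  using nat_less_eq_zless by linarith

lemma finite_coprime_pairs: "finite (coprime_pairs n)"
  by (rule finite_subset[of _ "{1..n} \<times> {1..n}"]) (auto simp: coprime_pairs_def)

text \<open>
  For a fixed direction \<open>y\<close> the height condition bounds \<open>u\<close> and \<open>v\<close> separately by the floor of
  \<open>X / pair_max y\<close>. Every \<open>n\<close> with \<open>X < n + 1\<close> is admitted, because pairs with a larger maximum contribute
  nothing; this allows the counts at \<open>X\<close> and at \<open>X / d\<close> to be expanded over the same set of pairs.
\<close>

lemma height_count_det_eq:
  assumes "X < real n + 1"
  shows "height_count V_det X = (\<Sum>y\<in>coprime_pairs n. (nat \<lfloor>X / real (pair_max y)\<rfloor>)\<^sup>2)"
proof -
  let ?m = "\<lambda>y. nat \<lfloor>X / real (pair_max y)\<rfloor>"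
  let ?T = "SIGMA y:coprime_pairs n. {1..?m y} \<times> {1..?m y}"
  have "{P \<in> branch_locus V_det. height P \<le> X} = outer_product ` ?T"
  proof (intro equalityI subsetI)
    fix P assume "P \<in> {P \<in> branch_locus V_det. height P \<le> X}"
    then have P: "P \<in> branch_locus V_det" "height P \<le> X" by auto
    obtain a b u v where abuv: "coprime a b" "a > 0" "b > 0" "u > 0" "v > 0" "P = outer_product ((a, b), (u, v))"
      using outer_product_surj[OF P(1)] .
    have h: "real u \<le> X / real (pair_max (a, b))" "real v \<le> X / real (pair_max (a, b))"
      using P(2) abuv height_outer_product_le_iff[of a b u v X] by auto
    have "1 \<le> real u" using abuv(4) by simp
    then have "1 \<le> X / real (pair_max (a, b))" using h(1) by linarith
    then have "real (pair_max (a, b)) \<le> X" using abuv(2) by (simp add: pair_max_def pos_le_divide_eq)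
    then have "real (max a b) < real (n + 1)" using assms by (simp add: pair_max_def)
    then have "max a b < n + 1" by (simp only: of_nat_less_iff)
    then have "(a, b) \<in> coprime_pairs n" using abuv by (simp add: coprime_pairs_def)
    moreover have "u \<in> {1..?m (a, b)}" "v \<in> {1..?m (a, b)}"
      using h abuv le_nat_floor_iff by auto
    ultimately show "P \<in> outer_product ` ?T" using abuv(6) by (auto intro!: image_eqI)
  next
    fix P assume "P \<in> outer_product ` ?T"
    then obtain a b u v where *: "(a, b) \<in> coprime_pairs n" "u \<in> {1..?m (a, b)}" "v \<in> {1..?m (a, b)}"
      "P = outer_product ((a, b), (u, v))" by auto
    then have pos: "a > 0" "b > 0" "u > 0" "v > 0" by (auto simp: coprime_pairs_def)
    then show "P \<in> {P \<in> branch_locus V_det. height P \<le> X}"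
      using * outer_product_in_branch_locus[OF pos] height_outer_product_le_iff[of a b u v X] le_nat_floor_iff by auto
  qed
  moreover have "inj_on outer_product ?T"
  proof (rule inj_onI)
    fix s t assume st: "s \<in> ?T" "t \<in> ?T" "outer_product s = outer_product t"
    obtain a b u v where s: "s = ((a, b), (u, v))" by (metis surj_pair)
    obtain a' b' u' v' where t: "t = ((a', b'), (u', v'))" by (metis surj_pair)
    show "s = t"
      unfolding s t by (rule outer_product_inj) (use st s t in \<open>auto simp: coprime_pairs_def\<close>)
  qed
  ultimately have "height_count V_det X = card ?T" by (simp add: height_count_def card_image)
  also have "\<dots> = (\<Sum>y\<in>coprime_pairs n. (?m y)\<^sup>2)"
    by (simp add: card_SigmaI finite_coprime_pairs card_cartesian_product power2_eq_square)
  finally show ?thesis .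
qed

lemma square_div_bounds:
  fixes k d :: nat
  assumes "d > 0"
  shows "(d * (k div d))\<^sup>2 \<le> k\<^sup>2" and "k\<^sup>2 \<le> (d * (k div d))\<^sup>2 + 2 * d * k"
proof -
  define q r where "q = d * (k div d)" and "r = k mod d"
  have k: "k = q + r" by (simp add: q_def r_def)
  have r: "r \<le> d" using assms by (simp add: r_def less_imp_le)
  show "(d * (k div d))\<^sup>2 \<le> k\<^sup>2" by (intro power_mono) auto
  have "k\<^sup>2 = q\<^sup>2 + r * (q + k)" by (simp add: k power2_eq_square algebra_simps)
  also have "r * (q + k) \<le> d * (2 * k)" using r k by (intro mult_mono) auto
  finally show "k\<^sup>2 \<le> (d * (k div d))\<^sup>2 + 2 * d * k" by (simp add: q_def)
qed

lemma nat_floor_divide: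
  assumes "d > 0"
  shows "nat \<lfloor>X / real d / real m\<rfloor> = nat \<lfloor>X / real m\<rfloor> div d"
proof -
  have "X / real d / real m = (X / real m) / of_int (int d)" by (simp add: mult.commute)
  then have "\<lfloor>X / real d / real m\<rfloor> = \<lfloor>X / real m\<rfloor> div int d"
    by (simp only: floor_divide_real_eq_div)
  then show ?thesis by (simp add: nat_div_distrib')
qed

text \<open>
  Split by which entry is the maximum. The pairs \<open>(a, b)\<close> with \<open>b \<le> a\<close> contribute \<open>a\<close> summands \<open>1 / a\<close> for each
  \<open>a\<close>, so \<open>n\<close> in total; the other half is symmetric.
\<close>

lemma sum_inverse_max_le: "(\<Sum>y\<in>{1..n} \<times> {1..n}. 1 / real (pair_max y)) \<le> 2 * real n"
proof -
  let ?g = "\<lambda>a b :: nat. if b \<le> a then 1 / real a else 0"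
  have g: "(\<Sum>a\<in>{1..n}. \<Sum>b\<in>{1..n}. ?g a b) = real n"
  proof -
    have "(\<Sum>b\<in>{1..n}. ?g a b) = 1" if "a \<in> {1..n}" for a
    proof -
      have "(\<Sum>b\<in>{1..n}. ?g a b) = (\<Sum>b\<in>{1..a}. 1 / real a)"
        using that by (intro sum.mono_neutral_cong_right) auto
      then show ?thesis using that by simp
    qed
    then show ?thesis by simp
  qed
  have "(\<Sum>y\<in>{1..n} \<times> {1..n}. 1 / real (pair_max y)) = (\<Sum>a\<in>{1..n}. \<Sum>b\<in>{1..n}. 1 / real (max a b))"
    by (simp add: sum.cartesian_product pair_max_def case_prod_beta)
  also have "\<dots> \<le> (\<Sum>a\<in>{1..n}. \<Sum>b\<in>{1..n}. ?g a b + ?g b a)"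
    by (intro sum_mono) (auto simp: max_def)
  also have "\<dots> = (\<Sum>a\<in>{1..n}. \<Sum>b\<in>{1..n}. ?g a b) + (\<Sum>a\<in>{1..n}. \<Sum>b\<in>{1..n}. ?g b a)"
    by (simp only: sum.distrib)
  also have "(\<Sum>a\<in>{1..n}. \<Sum>b\<in>{1..n}. ?g b a) = (\<Sum>a\<in>{1..n}. \<Sum>b\<in>{1..n}. ?g a b)"
    by (rule sum.swap)
  finally show ?thesis unfolding g by simp
qed

text \<open>
  Dividing \<open>X\<close> by \<open>d\<close> turns each floor \<open>k\<close> in the expansion over coprime pairs into \<open>k div d\<close>, so the
  comparison is made summand by summand. The error \<open>2 * d * k\<close> of a summand is at most
  \<open>2 * d * X / pair_max y\<close>, which sums to at most \<open>4 * d * X\<^sup>2\<close>.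
\<close>

lemma height_count_det_divide_le:
  assumes "d > 0" "X \<ge> 0"
  shows "(real d)\<^sup>2 * real (height_count V_det (X / real d)) \<le> real (height_count V_det X)"
    and "real (height_count V_det X) \<le> (real d)\<^sup>2 * real (height_count V_det (X / real d)) + 4 * real d * X\<^sup>2"
proof -
  define n where "n = nat \<lfloor>X\<rfloor>"
  have n: "X < real n + 1" "real n \<le> X" using assms by (auto simp: n_def)
  have "X / real d \<le> X / 1" using assms by (intro divide_left_mono) auto
  then have nd: "X / real d < real n + 1" using n by simp
  let ?k = "\<lambda>y. nat \<lfloor>X / real (pair_max y)\<rfloor>"
  have cd: "d\<^sup>2 * height_count V_det (X / real d) = (\<Sum>y\<in>coprime_pairs n. (d * (?k y div d))\<^sup>2)"
    by (simp del: divide_divide_eq_left add: height_count_det_eq[OF nd] nat_floor_divide assms sum_distrib_left power_mult_distrib)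
  have "d\<^sup>2 * height_count V_det (X / real d) \<le> height_count V_det X"
    unfolding cd height_count_det_eq[OF n(1)] by (intro sum_mono square_div_bounds assms)
  then show "(real d)\<^sup>2 * real (height_count V_det (X / real d)) \<le> real (height_count V_det X)"
    by (metis of_nat_le_iff of_nat_mult of_nat_power)
  have "height_count V_det X \<le> (\<Sum>y\<in>coprime_pairs n. (d * (?k y div d))\<^sup>2 + 2 * d * ?k y)"
    unfolding height_count_det_eq[OF n(1)] by (intro sum_mono square_div_bounds assms)
  then have "height_count V_det X \<le> d\<^sup>2 * height_count V_det (X / real d) + 2 * d * (\<Sum>y\<in>coprime_pairs n. ?k y)"
    by (simp add: cd sum.distrib sum_distrib_left)
  then have "real (height_count V_det X) \<le> real (d\<^sup>2 * height_count V_det (X / real d) + 2 * d * (\<Sum>y\<in>coprime_pairs n. ?k y))"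
    by (simp only: of_nat_le_iff)
  then have 1: "real (height_count V_det X) \<le>
      (real d)\<^sup>2 * real (height_count V_det (X / real d)) + 2 * real d * (\<Sum>y\<in>coprime_pairs n. real (?k y))"
    by simp
  have "(\<Sum>y\<in>coprime_pairs n. real (?k y)) \<le> (\<Sum>y\<in>coprime_pairs n. X * (1 / real (pair_max y)))"
    using assms by (intro sum_mono) (simp add: of_nat_floor)
  also have "\<dots> \<le> (\<Sum>y\<in>{1..n} \<times> {1..n}. X * (1 / real (pair_max y)))"
    using assms by (intro sum_mono2) (auto simp: coprime_pairs_def)
  also have "\<dots> \<le> X * (2 * real n)"
    unfolding sum_distrib_left[symmetric] using assms sum_inverse_max_le by (intro mult_left_mono) auto
  also have "\<dots> \<le> X * (2 * X)" using n assms by (intro mult_left_mono) auto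
  finally have "2 * real d * (\<Sum>y\<in>coprime_pairs n. real (?k y)) \<le> 2 * real d * (X * (2 * X))"
    by (intro mult_left_mono) auto
  with 1 show "real (height_count V_det X) \<le> (real d)\<^sup>2 * real (height_count V_det (X / real d)) + 4 * real d * X\<^sup>2"
    by (simp add: power2_eq_square mult_ac)
qed

text \<open>
  Over all pairs, the sum of the inverse squared maxima is at least the harmonic sum, since there are at
  least \<open>a\<close> pairs with maximum \<open>a\<close>. Each pair is a multiple \<open>c * y\<close> of a coprime pair \<open>y\<close>, so dropping the
  factors \<open>c\<close> costs at most the factor \<open>\<Sum>c. 1 / c\<^sup>2 \<le> 2\<close>.
\<close>

lemma harm_le_sum_coprime_pairs:
  "harm n \<le> 2 * (\<Sum>y\<in>coprime_pairs n. 1 / (real (pair_max y))\<^sup>2)"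
proof -
  let ?f = "\<lambda>y. 1 / (real (pair_max y))\<^sup>2"
  let ?S = "{1..n} \<times> coprime_pairs n"
  let ?g = "\<lambda>(c, (a, b)). (c * a, c * b :: nat)"
  have "harm n = (\<Sum>a\<in>{1..n}. \<Sum>b\<in>{1..a}. 1 / (real a)\<^sup>2)"
    by (simp add: harm_def inverse_eq_divide power2_eq_square)
  also have "\<dots> = (\<Sum>a\<in>{1..n}. \<Sum>b\<in>{1..a}. ?f (a, b))"
    by (intro sum.cong) (auto simp: pair_max_def max_def)
  also have "\<dots> \<le> (\<Sum>a\<in>{1..n}. \<Sum>b\<in>{1..n}. ?f (a, b))"
    by (intro sum_mono sum_mono2) auto
  also have "\<dots> = (\<Sum>y\<in>{1..n} \<times> {1..n}. ?f y)"
    by (simp add: sum.cartesian_product)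
  also have "\<dots> \<le> (\<Sum>y\<in>?g ` ?S. ?f y)"
  proof (intro sum_mono2)
    show "{1..n} \<times> {1..n} \<subseteq> ?g ` ?S"
    proof clarify
      fix a b assume ab: "a \<in> {1..n}" "b \<in> {1..n}"
      then obtain a' b' where *: "a = a' * gcd a b" "b = b' * gcd a b" "coprime a' b'"
        using gcd_coprime_exists[of a b] by auto
      have g: "gcd a b > 0" "gcd a b \<le> n" using ab le_trans[OF gcd_le1_nat[of a b], of n] by auto
      have "a' > 0" "b' > 0" using * ab by (metis atLeastAtMost_iff gr0I mult_0 not_one_le_zero)+
      moreover have "a' \<le> n" "b' \<le> n"
        using * ab g by (metis atLeastAtMost_iff le_trans nat_le_iff_add dvd_triv_left dvd_imp_le less_le_trans less_one linorder_not_less)+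
      ultimately have "(gcd a b, (a', b')) \<in> ?S"
        using *(3) g(2) Suc_leI[OF g(1)] by (simp add: coprime_pairs_def Suc_le_eq)
      then show "(a, b) \<in> ?g ` ?S" using * by (intro image_eqI) (auto simp: mult.commute)
    qed
  qed (auto simp: finite_coprime_pairs)
  also have "\<dots> \<le> (\<Sum>s\<in>?S. ?f (?g s))"
    using sum_image_le[of ?S ?f ?g] by (simp add: o_def finite_coprime_pairs)
  also have "\<dots> = (\<Sum>c\<in>{1..n}. \<Sum>y\<in>coprime_pairs n. 1 / (real c)\<^sup>2 * ?f y)"
    unfolding sum.cartesian_product
    by (intro sum.cong) (auto simp: pair_max_def power_mult_distrib simp flip: nat_mult_max_right)
  also have "\<dots> = (\<Sum>c\<in>{1..n}. 1 / (real c)\<^sup>2) * (\<Sum>y\<in>coprime_pairs n. ?f y)"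
    by (simp add: sum_product)
  also have "\<dots> \<le> 2 * (\<Sum>y\<in>coprime_pairs n. ?f y)"
  proof (intro mult_right_mono sum_nonneg)
    have "{1..n} \<subseteq> insert 1 {1<..n}" by auto
    then have "(\<Sum>c\<in>{1..n}. 1 / (real c)\<^sup>2) \<le> (\<Sum>c\<in>insert 1 {1<..n}. 1 / (real c)\<^sup>2)"
      by (intro sum_mono2) auto
    also have "\<dots> \<le> 2" using inverse_squares_tail_le[of 1 n] by simp
    finally show "(\<Sum>c\<in>{1..n}. 1 / (real c)\<^sup>2) \<le> 2" .
  qed auto
  finally show ?thesis .
qed

text \<open>
  The floor of a number that is at least \<open>1\<close> is at least half of it, so the count is at least a quarter of
  \<open>X\<^sup>2\<close> times the sum of the inverse squared maxima of the coprime pairs.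
\<close>

lemma height_count_det_ge:
  assumes "X \<ge> 0"
  shows "X\<^sup>2 * harm (nat \<lfloor>X\<rfloor>) \<le> 8 * real (height_count V_det X)"
proof -
  define n where "n = nat \<lfloor>X\<rfloor>"
  have n: "X < real n + 1" "real n \<le> X" using assms by (auto simp: n_def)
  have half: "(X / real (pair_max y))\<^sup>2 \<le> 4 * real ((nat \<lfloor>X / real (pair_max y)\<rfloor>)\<^sup>2)" if "y \<in> coprime_pairs n" for y
  proof -
    let ?z = "X / real (pair_max y)"
    have "real (pair_max y) \<le> X" "pair_max y > 0"
      using that n(2) by (auto simp: coprime_pairs_def pair_max_def)
    then have "1 \<le> ?z" by simp
    have "z \<le> 2 * real (nat \<lfloor>z\<rfloor>)" if "1 \<le> z" for z :: real
    proof -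
      have "1 \<le> nat \<lfloor>z\<rfloor>" using that by (intro le_nat_floor) simp
      then have "1 \<le> real (nat \<lfloor>z\<rfloor>)" by simp
      moreover have "z < real (nat \<lfloor>z\<rfloor>) + 1" using that by linarith
      ultimately show ?thesis by linarith
    qed
    then have "?z \<le> 2 * real (nat \<lfloor>?z\<rfloor>)" using \<open>1 \<le> ?z\<close> by blast
    then have "?z\<^sup>2 \<le> (2 * real (nat \<lfloor>?z\<rfloor>))\<^sup>2" using \<open>1 \<le> ?z\<close> by (intro power_mono) auto
    then show ?thesis by (simp add: power_mult_distrib)
  qed
  have "X\<^sup>2 * harm n \<le> X\<^sup>2 * (2 * (\<Sum>y\<in>coprime_pairs n. 1 / (real (pair_max y))\<^sup>2))"
    by (intro mult_left_mono harm_le_sum_coprime_pairs) auto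
  also have "\<dots> = 2 * (\<Sum>y\<in>coprime_pairs n. (X / real (pair_max y))\<^sup>2)"
    by (simp add: sum_distrib_left power_divide mult.commute)
  also have "\<dots> \<le> 2 * (\<Sum>y\<in>coprime_pairs n. 4 * real ((nat \<lfloor>X / real (pair_max y)\<rfloor>)\<^sup>2))"
    by (intro mult_left_mono sum_mono half) auto
  also have "\<dots> = 8 * real (height_count V_det X)"
    by (simp add: height_count_det_eq[OF n(1)] sum_distrib_left)
  finally show ?thesis by (simp add: n_def)
qed

lemma square_over_height_count_det_tendsto_0: "((\<lambda>X. X\<^sup>2 / real (height_count V_det X)) \<longlongrightarrow> 0) at_top"
proof -
  have fl: "filterlim (\<lambda>X::real. nat \<lfloor>X\<rfloor>) sequentially at_top"
    by (rule filterlim_compose[OF filterlim_nat_sequentially filterlim_floor_sequentially])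
  have harm: "filterlim (\<lambda>X::real. harm (nat \<lfloor>X\<rfloor>) :: real) at_top at_top"
    by (rule filterlim_compose[OF harm_at_top fl])
  then have lim: "((\<lambda>X::real. 8 / harm (nat \<lfloor>X\<rfloor>)) \<longlongrightarrow> (0::real)) at_top"
    by (intro tendsto_divide_0[OF tendsto_const] filterlim_at_top_imp_at_infinity)
  show ?thesis
  proof (rule tendsto_sandwich[OF _ _ tendsto_const lim])
    show "\<forall>\<^sub>F X in at_top. 0 \<le> X\<^sup>2 / real (height_count V_det X)" by simp
    show "\<forall>\<^sub>F X in at_top. X\<^sup>2 / real (height_count V_det X) \<le> 8 / harm (nat \<lfloor>X\<rfloor>)"
      using eventually_ge_at_top[of 1]
    proof eventually_elim
      case (elim X)
      have h: "harm (nat \<lfloor>X\<rfloor>) > (0::real)" using elim by (intro harm_pos) simp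
      have le: "X\<^sup>2 * harm (nat \<lfloor>X\<rfloor>) \<le> 8 * real (height_count V_det X)" using elim by (intro height_count_det_ge) simp
      have "X\<^sup>2 * harm (nat \<lfloor>X\<rfloor>) > 0" using elim h by simp
      then have "real (height_count V_det X) > 0" using le by linarith
      then show ?case using le h by (simp add: field_simps)
    qed
  qed
qed

text \<open>
  Both sides of \<open>height_count_det_divide_le\<close> are divided by \<open>d\<^sup>2\<close> times the count at \<open>X\<close>; the error
  term vanishes in the limit because \<open>X\<^sup>2\<close> is negligible against that count.
\<close>

lemma height_count_det_ratio_tendsto:
  assumes "d > 0"
  shows "((\<lambda>X. real (height_count V_det (X / real d)) / real (height_count V_det X)) \<longlongrightarrow> 1 / (real d)\<^sup>2) at_top"
proof (rule tendsto_sandwich)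
  have d: "(real d)\<^sup>2 > 0" using assms by simp
  have pos: "\<forall>\<^sub>F X in at_top. real (height_count V_det X) > 0"
    using eventually_ge_at_top[of 1]
  proof eventually_elim
    case (elim X)
    have "harm (nat \<lfloor>X\<rfloor>) > (0::real)" using elim by (intro harm_pos) simp
    then have "X\<^sup>2 * harm (nat \<lfloor>X\<rfloor>) > 0" using elim by simp
    then show ?case using height_count_det_ge[of X] elim by linarith
  qed
  show "\<forall>\<^sub>F X in at_top. 1 / (real d)\<^sup>2 - 4 / real d * (X\<^sup>2 / real (height_count V_det X))
      \<le> real (height_count V_det (X / real d)) / real (height_count V_det X)"
    using pos eventually_ge_at_top[of 0]
  proof eventually_elim
    case (elim X)
    have "real (height_count V_det X) - 4 * real d * X\<^sup>2 \<le> (real d)\<^sup>2 * real (height_count V_det (X / real d))"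
      using height_count_det_divide_le(2)[OF assms elim(2)] by simp
    then have "(real (height_count V_det X) - 4 * real d * X\<^sup>2) / ((real d)\<^sup>2 * real (height_count V_det X))
        \<le> ((real d)\<^sup>2 * real (height_count V_det (X / real d))) / ((real d)\<^sup>2 * real (height_count V_det X))"
      using elim d by (intro divide_right_mono) auto
    moreover have "(real (height_count V_det X) - 4 * real d * X\<^sup>2) / ((real d)\<^sup>2 * real (height_count V_det X))
        = 1 / (real d)\<^sup>2 - 4 / real d * (X\<^sup>2 / real (height_count V_det X))"
      using elim assms by (simp add: diff_divide_distrib power2_eq_square)
    ultimately show ?case using assms by simp
  qed
  show "\<forall>\<^sub>F X in at_top. real (height_count V_det (X / real d)) / real (height_count V_det X) \<le> 1 / (real d)\<^sup>2"
    using pos eventually_ge_at_top[of 0]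
  proof eventually_elim
    case (elim X)
    then show ?case
      using height_count_det_divide_le(1)[OF assms elim(2)] d by (simp add: field_simps)
  qed
  have "((\<lambda>X. 1 / (real d)\<^sup>2 - 4 / real d * (X\<^sup>2 / real (height_count V_det X))) \<longlongrightarrow> 1 / (real d)\<^sup>2 - 4 / real d * 0) at_top"
    by (intro tendsto_intros square_over_height_count_det_tendsto_0)
  then show "((\<lambda>X. 1 / (real d)\<^sup>2 - 4 / real d * (X\<^sup>2 / real (height_count V_det X))) \<longlongrightarrow> 1 / (real d)\<^sup>2) at_top"
    by simp
qed (rule tendsto_const)

section \<open>The densities of the determinantal hypersurface\<close>

lemma the_density_eq: "has_density S B d \<Longrightarrow> (THE d. has_density S B d) = d"
  unfolding has_density_def by (blast intro: the_equality tendsto_unique[OF trivial_limit_at_top_linorder])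

theorem proposition4p11:
  fixes rep :: "(real ^ 4) set \<Rightarrow> real ^ 4"
  assumes "ray_representatives V_det rep"
  shows "has_density (globally_visible_points V_det rep) (branch_locus V_det) (1 / zeta 2) \<and>
    global_vis_density V_det rep = 1 / zeta 2 \<and>
    (\<forall>p. prime p \<longrightarrow>
       has_density (locally_visible_points p V_det rep) (branch_locus V_det) (1 - 1 / (real p)\<^sup>2) \<and>
       local_vis_density p V_det rep = 1 - 1 / (real p)\<^sup>2) \<and>
    locally_detectable V_det rep \<and>
    (\<lambda>n. if prime n then local_vis_density n V_det rep else 1) has_prod global_vis_density V_det rep"
proof -
  have cone: "c *\<^sub>R x \<in> V_det" if "x \<in> V_det" "c > 0" for x and c :: real
    using that by (simp add: V_det_def)
  note density = has_density_by_coord_gcd[of V_det, OF cone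
      height_count_det_ratio_tendsto height_count_det_divide_le(1)]
  have glob: "has_density (globally_visible_points V_det rep) (branch_locus V_det) (1 / zeta 2)"
    unfolding globally_visible_points_eq[OF assms] by (rule density(1))
  have loc: "has_density (locally_visible_points p V_det rep) (branch_locus V_det) (1 - 1 / (real p)\<^sup>2)"
    if "prime p" for p
    unfolding locally_visible_points_eq[OF assms that] by (rule density(2)) (use that prime_gt_0_nat in auto)
  have glob_eq: "global_vis_density V_det rep = 1 / zeta 2"
    unfolding global_vis_density_def by (rule the_density_eq[OF glob])
  have loc_eq: "local_vis_density p V_det rep = 1 - 1 / (real p)\<^sup>2" if "prime p" for p
    unfolding local_vis_density_def by (rule the_density_eq[OF loc[OF that]])
  let ?f = "\<lambda>n. if prime n then local_vis_density n V_det rep else 1"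
  have "(\<Prod>i\<le>n. ?f (i + 0)) = (\<Prod>p | prime p \<and> p \<le> n. 1 - 1 / (real p)\<^sup>2)" for n
    by (rule prod.mono_neutral_cong_right) (auto simp: loc_eq)
  then have "raw_has_prod ?f 0 (1 / zeta 2)"
    using zeta_2_Euler_product zeta_2_pos by (simp add: raw_has_prod_def)
  then have "?f has_prod global_vis_density V_det rep"
    unfolding glob_eq has_prod_def by blast
  then show ?thesis
    using glob glob_eq loc loc_eq locally_detectable_ray_datum by blast
qed

end
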